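(* Let $m,n$ be integers with $3\leqslant m\leqslant n$. Then the grid graph $Grid_{m\times n}$ is $d$-balanced, i.e. $\gamma_{bd}(Grid_{m\times n})=0$.
   Context: For a simple undirected finite graph $G$ and $v\in V(G)$, the closed neighborhood is $N_G[v]=\{u\in V(G): uv\in E(G)\}\cup\{v\}$. A function $f\colon V(G)\to\{-1,0,1\}$ is a balanced domination function (BDF) on $G$ if $\sum_{u\in N_G[v]} f(u)=0$ for every $v\in V(G)$. Its weight is $\omega_f=\sum_{v\in V(G)} f(v)$. The balanced domination number $\gamma_{bd}(G)$ is the maximum of $\omega_f$ over all BDFs $f$ on $G$. The graph $G$ is called $d$-balanced if $\gamma_{bd}(G)=0$. The grid graph $Grid_{m\times n}$ is the Cartesian product $P_m\square P_n$ of paths with $m$ and $n$ vertices: its vertices are $v_{i,j}$, $1\leqslant i\leqslant m$, $1\leqslant j\leqslant n$, and two vertices are adjacent iff they are consecutive in the same row or consecutive in the same column. *)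

theory Defs
  imports "Graph_Theory.Pair_Digraph" "HOL-Library.FuncSet"
begin

text \<open>
  A finite simple undirected graph is a graph in the sense of \<^locale>\<open>pair_graph\<close>: a finite
  loop-free digraph whose arc set is symmetric, an edge being represented by its two arcs.
\<close>

definition closed_neighborhood :: "'a pair_pre_digraph \<Rightarrow> 'a \<Rightarrow> 'a set" where
  "closed_neighborhood G v = {u \<in> pverts G. (u, v) \<in> parcs G} \<union> {v}"

text \<open>Values of \<open>f\<close> outside the vertex set are irrelevant.\<close>

definition bdf :: "'a pair_pre_digraph \<Rightarrow> ('a \<Rightarrow> int) \<Rightarrow> bool" where
  "bdf G f \<longleftrightarrow> f \<in> pverts G \<rightarrow> {-1, 0, 1} \<and>
     (\<forall>v\<in>pverts G. (\<Sum>u\<in>closed_neighborhood G v. f u) = 0)"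

definition weight :: "'a pair_pre_digraph \<Rightarrow> ('a \<Rightarrow> int) \<Rightarrow> int" where
  "weight G f = (\<Sum>v\<in>pverts G. f v)"

definition balanced_domination_number :: "'a pair_pre_digraph \<Rightarrow> int" where
  "balanced_domination_number G = Max {weight G f | f. bdf G f}"

definition d_balanced :: "'a pair_pre_digraph \<Rightarrow> bool" where
  "d_balanced G \<longleftrightarrow> balanced_domination_number G = 0"

text \<open>The maximum is taken over a finite nonempty set.\<close>

lemma bdf_zero: "bdf G (\<lambda>_. 0)"
  by (simp add: bdf_def)

lemma weights_nonempty: "{weight G f | f. bdf G f} \<noteq> {}"
  using bdf_zero by blast

lemma weights_finite:
  assumes "finite (pverts G)"
  shows "finite {weight G f | f. bdf G f}"
proof (rule finite_subset)
  let ?n = "int (card (pverts G))"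
  show "{weight G f | f. bdf G f} \<subseteq> {-?n..?n}"
  proof clarify
    fix f assume "bdf G f"
    then have f: "\<bar>f v\<bar> \<le> 1" if "v \<in> pverts G" for v
      using that by (auto simp: bdf_def Pi_iff)
    have "\<bar>weight G f\<bar> \<le> (\<Sum>v\<in>pverts G. \<bar>f v\<bar>)"
      unfolding weight_def by (rule sum_abs)
    also have "\<dots> \<le> (\<Sum>v\<in>pverts G. 1)"
      by (rule sum_mono) (rule f)
    finally show "weight G f \<in> {-?n..?n}" by auto
  qed
qed simp

definition path_graph :: "nat \<Rightarrow> nat pair_pre_digraph" where
  "path_graph n = \<lparr>pverts = {1..n},
     parcs = {(i, j). i \<in> {1..n} \<and> j \<in> {1..n} \<and> (j = i + 1 \<or> i = j + 1)}\<rparr>"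

definition cartesian_product ::
    "'a pair_pre_digraph \<Rightarrow> 'b pair_pre_digraph \<Rightarrow> ('a \<times> 'b) pair_pre_digraph" where
  "cartesian_product G H = \<lparr>pverts = pverts G \<times> pverts H,
     parcs = {((a, b), (a', b')).
        a \<in> pverts G \<and> a' \<in> pverts G \<and> b \<in> pverts H \<and> b' \<in> pverts H \<and>
        (a = a' \<and> (b, b') \<in> parcs H \<or> b = b' \<and> (a, a') \<in> parcs G)}\<rparr>"

definition grid_graph :: "nat \<Rightarrow> nat \<Rightarrow> (nat \<times> nat) pair_pre_digraph" where
  "grid_graph m n = cartesian_product (path_graph m) (path_graph n)"

lemma pverts_grid_graph: "pverts (grid_graph m n) = {1..m} \<times> {1..n}"
  by (simp add: grid_graph_def cartesian_product_def path_graph_def)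

lemma parcs_grid_graph_iff:
  "((i, j), (i', j')) \<in> parcs (grid_graph m n) \<longleftrightarrow>
     (i, j) \<in> {1..m} \<times> {1..n} \<and> (i', j') \<in> {1..m} \<times> {1..n} \<and>
     (i = i' \<and> (j' = j + 1 \<or> j = j' + 1) \<or> j = j' \<and> (i' = i + 1 \<or> i = i' + 1))"
  by (auto simp: grid_graph_def cartesian_product_def path_graph_def)

lemma pair_graph_grid_graph: "pair_graph (grid_graph m n)"
proof -
  have sub: "parcs (grid_graph m n) \<subseteq> pverts (grid_graph m n) \<times> pverts (grid_graph m n)"
    by (auto simp: pverts_grid_graph parcs_grid_graph_iff)
  have fin: "finite (pverts (grid_graph m n))"
    by (simp add: pverts_grid_graph)
  have finarcs: "finite (parcs (grid_graph m n))"
    using sub fin by (meson finite_SigmaI finite_subset)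
  have loopfree: "fst e \<noteq> snd e" if "e \<in> parcs (grid_graph m n)" for e
    using that by (cases e) (auto simp: parcs_grid_graph_iff)
  have sym: "sym (parcs (grid_graph m n))"
    by (rule symI) (auto simp: parcs_grid_graph_iff)
  have symm: "symmetric (with_proj (grid_graph m n))"
    using sym by (simp add: symmetric_def arcs_ends_def arc_to_ends_def)
  show ?thesis
    by unfold_locales (use sub fin finarcs loopfree symm in auto)
qed

end

theory Submission
  imports Defs
begin

text \<open>
  Extend a BDF to a function \<open>F\<close> on the integer lattice that is odd about the lines \<open>i = 0\<close>,
  \<open>i = m + 1\<close>, \<open>j = 0\<close>, \<open>j = n + 1\<close>. Let \<open>U\<close> and \<open>V\<close> sum the two horizontal, respectively
  vertical, neighbours; then \<open>1 + U + V\<close> annihilates \<open>F\<close> everywhere. Substituting \<open>V = -1 - U\<close>, the plus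
  dilated by \<open>7\<close> acts on \<open>F\<close> as \<open>-7 Q(U)\<close> with \<open>Q(U) = U(U+1)(U-1)(U+2)(U\<^sup>2+U-1)\<close>
  (it is congruent to \<open>(1 + U + V)\<^sup>7\<close> modulo the prime \<open>7\<close>). It adds up only five values in
  \<open>{-1, 0, 1}\<close>, so the result, being divisible by \<open>7\<close>, is zero and \<open>Q(U) F = 0\<close>. By oddness
  \<open>U + 2\<close> and \<open>V + 2 = 1 - U\<close> are injective, so \<open>U(U+1)(U\<^sup>2+U-1) F = 0\<close>. Splitting along the factors,
  \<open>F\<close> is a sum of functions with horizontal period \<open>5\<close> or \<open>3\<close> or with vertical period \<open>3\<close>,
  and an odd period together with oddness makes the sums over the grid vanish.
\<close>

definition hsum :: "(int \<Rightarrow> int \<Rightarrow> int) \<Rightarrow> int \<Rightarrow> int \<Rightarrow> int" where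
  "hsum F i j = F (i - 1) j + F (i + 1) j"

definition vsum :: "(int \<Rightarrow> int \<Rightarrow> int) \<Rightarrow> int \<Rightarrow> int \<Rightarrow> int" where
  "vsum F i j = F i (j - 1) + F i (j + 1)"

section \<open>Odd and periodic functions on the integers\<close>

definition odd_about :: "int \<Rightarrow> (int \<Rightarrow> int) \<Rightarrow> bool" where
  "odd_about c g \<longleftrightarrow> (\<forall>i. g (2 * c - i) = - g i)"

lemma odd_about_centre: "odd_about c g \<Longrightarrow> g c = 0"
  unfolding odd_about_def by (drule spec[of _ c]) simp

lemma periodic_multiple:
  fixes g :: "int \<Rightarrow> int"
  assumes "\<And>i. g (i + p) = g i"
  shows "g (i + p * k) = g i"
proof -
  have nat_case: "g (i + p * int n) = g i" for n i
  proof (induction n)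
    case (Suc n)
    have "g (i + p * int (Suc n)) = g ((i + p * int n) + p)" by (simp add: algebra_simps)
    then show ?case using Suc assms by simp
  qed simp
  show ?thesis
  proof (cases "k \<ge> 0")
    case True
    then show ?thesis using nat_case[of i "nat k"] by simp
  next
    case False
    then show ?thesis using nat_case[of "i + p * k" "nat (- k)"] by simp
  qed
qed

lemma odd_about_periodic:
  assumes "odd_about 0 g" "odd_about M g"
  shows "g (i + 2 * M * k) = g i"
proof (rule periodic_multiple)
  fix i
  have "g (i + 2 * M) = g (2 * M - (- i))" by (simp add: algebra_simps)
  also have "\<dots> = - g (- i)" using assms(2) unfolding odd_about_def by blast
  also have "\<dots> = g i" using assms(1) by (simp add: odd_about_def)
  finally show "g (i + 2 * M) = g i" .
qed

text \<open>Both \<open>p\<close> and \<open>2 M\<close> are periods, hence so is \<open>M = (p + 1) M - p M\<close>, so the reflection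
  \<open>i \<mapsto> M - i\<close> reverses the sign of \<open>g\<close>.\<close>

lemma sum_odd_about_odd_period:
  assumes g: "odd_about 0 g" "odd_about M g" and per: "\<And>i. g (i + p) = g i" and p: "odd p"
  shows "(\<Sum>i=1..M-1. g i) = 0"
proof -
  obtain q where q: "p = 2 * q + 1" using p by (rule oddE)
  have refl: "g (M - i) = - g i" for i
  proof -
    have "g (M - i) = g ((M - i) + p * M)" using periodic_multiple[of g p, OF per] by simp
    also have "(M - i) + p * M = - i + 2 * M * (q + 1)" by (simp add: q algebra_simps)
    also have "g \<dots> = g (- i)" by (rule odd_about_periodic[OF g])
    finally show ?thesis using g(1) by (simp add: odd_about_def)
  qed
  have "(\<Sum>i=1..M-1. g i) = (\<Sum>i=1..M-1. g (M - i))"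
    by (rule sum.reindex_bij_witness[of _ "\<lambda>i. M - i" "\<lambda>i. M - i"]) auto
  then show ?thesis by (simp add: refl sum_negf)
qed

text \<open>By period \<open>2 * M\<close> only residues matter; the centres \<open>0\<close> and
  \<open>M\<close> vanish, and reflection in \<open>M\<close> covers the rest.\<close>

lemma zero_if_odd_about_zero:
  assumes g: "odd_about 0 g" "odd_about M g" and M: "M > 0"
    and zero: "\<And>i. 0 < i \<Longrightarrow> i < M \<Longrightarrow> g i = 0"
  shows "g i = 0"
proof -
  let ?r = "i mod (2 * M)"
  have r: "0 \<le> ?r" "?r < 2 * M" using M by simp_all
  have eq: "g i = g ?r"
    using odd_about_periodic[OF g, of ?r "i div (2 * M)"] by (simp add: add.commute)
  have refl: "g (2 * M - ?r) = - g ?r" using g(2) by (simp add: odd_about_def)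
  consider "?r = 0" | "0 < ?r" "?r < M" | "?r = M" | "M < ?r" using r by linarith
  then have "g ?r = 0"
  proof cases
    case 4
    then show ?thesis using refl r zero[of "2 * M - ?r"] by simp
  qed (use odd_about_centre[OF g(1)] odd_about_centre[OF g(2)] zero in auto)
  then show ?thesis using eq by simp
qed

text \<open>The characteristic polynomial is \<open>(x + 1)^2\<close>, so \<open>g 0 = 0\<close>
  forces \<open>g k = (-1)^(k+1) * k * g 1\<close>, and \<open>g M = 0\<close> then gives
  \<open>g 1 = 0\<close>.\<close>

lemma zero_if_hsum_plus_two_zero:
  assumes g: "odd_about 0 g" "odd_about M g" and M: "M > 0"
    and rec: "\<And>i. g (i - 1) + g (i + 1) + 2 * g i = 0"
  shows "g i = 0"
proof -
  have "g 0 = 0" "g M = 0" using g by (simp_all add: odd_about_centre)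
  have alt: "g (int k) = (-1) ^ (k + 1) * int k * g 1 \<and>
     g (int (k + 1)) = (-1) ^ k * int (k + 1) * g 1" for k
  proof (induction k)
    case (Suc k)
    have "g (int k) + g (int (Suc k + 1)) + 2 * g (int (k + 1)) = 0"
      using rec[of "int k + 1"] by (simp add: algebra_simps)
    then show ?case using Suc by (simp add: algebra_simps)
  qed (simp add: \<open>g 0 = 0\<close>)
  have "g 1 = 0" using alt[of "nat M"] M \<open>g M = 0\<close> by simp
  then have "g (int k) = 0" for k using alt[of k] by simp
  then show ?thesis
    using zero_if_odd_about_zero[OF g M] by (metis zero_less_imp_eq_int)
qed

section \<open>Lattice functions odd in both coordinates\<close>

definition doubly_odd :: "int \<Rightarrow> int \<Rightarrow> (int \<Rightarrow> int \<Rightarrow> int) \<Rightarrow> bool" where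
  "doubly_odd M N F \<longleftrightarrow>
     (\<forall>j. odd_about 0 (\<lambda>i. F i j) \<and> odd_about M (\<lambda>i. F i j)) \<and>
     (\<forall>i. odd_about 0 (F i) \<and> odd_about N (F i))"

lemma doubly_odd_swap: "doubly_odd N M (\<lambda>j i. F i j) \<longleftrightarrow> doubly_odd M N F"
  by (auto simp: doubly_odd_def)

lemma doubly_odd_hsum:
  assumes "doubly_odd M N F"
  shows "doubly_odd M N (hsum F)"
proof -
  have row: "F (- i) j = - F i j" "F (2 * M - i) j = - F i j" for i j
    using assms by (simp_all add: doubly_odd_def odd_about_def)
  have r0: "hsum F (- i) j = - hsum F i j" for i j
    using row(1)[of "i + 1" j] row(1)[of "i - 1" j] by (simp add: hsum_def)
  have rM: "hsum F (2 * M - i) j = - hsum F i j" for i j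
    using row(2)[of "i + 1" j] row(2)[of "i - 1" j] by (simp add: hsum_def algebra_simps)
  have c: "hsum F i (- j) = - hsum F i j" "hsum F i (2 * N - j) = - hsum F i j" for i j
    using assms by (simp_all add: doubly_odd_def odd_about_def hsum_def)
  show ?thesis by (simp add: doubly_odd_def odd_about_def r0 rM c)
qed

lemma doubly_odd_vsum: "doubly_odd M N F \<Longrightarrow> doubly_odd M N (vsum F)"
  using doubly_odd_hsum[of N M "\<lambda>j i. F i j"] doubly_odd_swap[of N M F]
    doubly_odd_swap[of N M "vsum F"]
  by (simp add: hsum_def[abs_def] vsum_def[abs_def])

lemma doubly_odd_lincomb:
  "doubly_odd M N F \<Longrightarrow> doubly_odd M N G \<Longrightarrow> doubly_odd M N (\<lambda>i j. a * F i j + b * G i j)"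
  by (simp add: doubly_odd_def odd_about_def)

lemma zero_if_doubly_odd_zero:
  assumes F: "doubly_odd M N F" and pos: "M > 0" "N > 0"
    and zero: "\<And>i j. 0 < i \<Longrightarrow> i < M \<Longrightarrow> 0 < j \<Longrightarrow> j < N \<Longrightarrow> F i j = 0"
  shows "F i j = 0"
proof (rule zero_if_odd_about_zero[of "\<lambda>i. F i j"])
  fix i assume i: "0 < i" "i < M"
  show "F i j = 0"
    by (rule zero_if_odd_about_zero[of "F i"]) (use F pos zero i in \<open>auto simp: doubly_odd_def\<close>)
qed (use F pos in \<open>auto simp: doubly_odd_def\<close>)

section \<open>Balanced odd functions and polynomials in the horizontal neighbour sum\<close>

definition odd_balanced :: "int \<Rightarrow> int \<Rightarrow> (int \<Rightarrow> int \<Rightarrow> int) \<Rightarrow> bool" where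
  "odd_balanced M N F \<longleftrightarrow> doubly_odd M N F \<and> (\<forall>i j. F i j + hsum F i j + vsum F i j = 0)"

lemma odd_balanced_row:
  "odd_balanced M N F \<Longrightarrow> odd_about 0 (\<lambda>i. F i j)"
  "odd_balanced M N F \<Longrightarrow> odd_about M (\<lambda>i. F i j)"
  by (simp_all add: odd_balanced_def doubly_odd_def)

lemma odd_balanced_column:
  "odd_balanced M N F \<Longrightarrow> odd_about 0 (F i)"
  "odd_balanced M N F \<Longrightarrow> odd_about N (F i)"
  by (simp_all add: odd_balanced_def doubly_odd_def)

lemma odd_balanced_sum: "odd_balanced M N F \<Longrightarrow> F i j + hsum F i j + vsum F i j = 0"
  by (simp add: odd_balanced_def)

lemma odd_balanced_hsum:
  assumes "odd_balanced M N F"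
  shows "odd_balanced M N (hsum F)"
proof -
  have "hsum F i j + hsum (hsum F) i j + vsum (hsum F) i j = 0" for i j
    using odd_balanced_sum[OF assms, of "i - 1" j] odd_balanced_sum[OF assms, of "i + 1" j]
    by (simp add: hsum_def vsum_def)
  then show ?thesis using assms by (simp add: odd_balanced_def doubly_odd_hsum)
qed

lemma odd_balanced_lincomb:
  assumes "odd_balanced M N F" "odd_balanced M N G"
  shows "odd_balanced M N (\<lambda>i j. a * F i j + b * G i j)"
proof -
  have "(a * F i j + b * G i j) + hsum (\<lambda>i j. a * F i j + b * G i j) i j
      + vsum (\<lambda>i j. a * F i j + b * G i j) i j
    = a * (F i j + hsum F i j + vsum F i j) + b * (G i j + hsum G i j + vsum G i j)" for i j
    by (simp add: hsum_def vsum_def algebra_simps)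
  then show ?thesis using assms by (simp add: odd_balanced_def doubly_odd_lincomb)
qed

text \<open>\<open>dilated_vsum k\<close> is the Chebyshev polynomial with \<open>2 cos t \<mapsto> 2 cos (k t)\<close>, evaluated at
  \<open>- 1 - hsum\<close>, which acts on a balanced function as \<open>vsum\<close> does.\<close>

fun dilated_vsum :: "nat \<Rightarrow> (int \<Rightarrow> int) \<Rightarrow> int \<Rightarrow> int" where
  "dilated_vsum 0 g i = 2 * g i"
| "dilated_vsum (Suc 0) g i = - (g (i - 1) + g i + g (i + 1))"
| "dilated_vsum (Suc (Suc k)) g i =
     - (dilated_vsum (Suc k) g (i - 1) + dilated_vsum (Suc k) g i + dilated_vsum (Suc k) g (i + 1))
     - dilated_vsum k g i"

lemma dilated_vsum:
  assumes bal: "\<And>i j. F i j + hsum F i j + vsum F i j = 0"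
  shows "F i (j - int k) + F i (j + int k) = dilated_vsum k (\<lambda>i. F i j) i"
proof (induction k "\<lambda>i. F i j" i rule: dilated_vsum.induct)
  case (2 i)
  then show ?case using bal[of i j] by (simp add: hsum_def vsum_def)
next
  case (3 k i)
  \<comment> \<open>Balance at height \<open>k + 1\<close> above and below \<open>j\<close> reaches
    distance \<open>k + 2\<close>.\<close>
  then show ?case using bal[of i "j + int k + 1"] bal[of i "j - int k - 1"]
    by (simp add: hsum_def vsum_def algebra_simps)
qed simp

definition hpoly :: "int \<Rightarrow> (int \<Rightarrow> int \<Rightarrow> int) \<Rightarrow> int \<Rightarrow> int \<Rightarrow> int" where
  "hpoly c F i j = hsum F i j + c * F i j"

text \<open>With \<open>U = x + 1/x\<close>, \<open>U^2 + U - 1\<close> is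
  \<open>x^2 + x + 1 + 1/x + 1/x^2\<close>: the sum of five consecutive values.\<close>

definition hquint :: "(int \<Rightarrow> int \<Rightarrow> int) \<Rightarrow> int \<Rightarrow> int \<Rightarrow> int" where
  "hquint F i j = hsum (hsum F) i j + hsum F i j - F i j"

lemma dilated_sum_seven:
  assumes bal: "\<And>i j. F i j + hsum F i j + vsum F i j = 0"
  shows "F i j + F (i - 7) j + F (i + 7) j + F i (j - 7) + F i (j + 7)
    = - 7 * hpoly 2 (hpoly (- 1) (hpoly 0 (hpoly 1 (hquint F)))) i j"
proof -
  have "F i (j - 7) + F i (j + 7) = dilated_vsum 7 (\<lambda>i. F i j) i"
    using dilated_vsum[OF bal, of i j 7] by simp
  then show ?thesis
    by (simp add: hpoly_def hquint_def hsum_def eval_nat_numeral algebra_simps)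
qed

lemma odd_balanced_hpoly: "odd_balanced M N F \<Longrightarrow> odd_balanced M N (hpoly c F)"
  using odd_balanced_lincomb[OF odd_balanced_hsum, of M N F F 1 c] by (simp add: hpoly_def[abs_def])

lemma odd_balanced_hquint:
  assumes "odd_balanced M N F"
  shows "odd_balanced M N (hquint F)"
proof -
  have "odd_balanced M N (\<lambda>i j. 1 * hsum (hpoly 1 F) i j + (- 1) * F i j)"
    by (intro odd_balanced_lincomb odd_balanced_hsum odd_balanced_hpoly assms)
  moreover have "(\<lambda>i j. 1 * hsum (hpoly 1 F) i j + (- 1) * F i j) = hquint F"
    by (auto simp: fun_eq_iff hquint_def hpoly_def hsum_def)
  ultimately show ?thesis by simp
qed

lemma hpoly_two_eq_zero:
  assumes F: "odd_balanced M N F" and "M > 0" and zero: "\<And>i j. hpoly 2 F i j = 0"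
  shows "F i j = 0"
proof (rule zero_if_hsum_plus_two_zero[of "\<lambda>i. F i j"])
  show "F (i - 1) j + F (i + 1) j + 2 * F i j = 0" for i
    using zero[of i j] by (simp add: hpoly_def hsum_def)
qed (use odd_balanced_row[OF F] \<open>M > 0\<close> in auto)

text \<open>On a balanced function \<open>hsum - 1\<close> acts as \<open>- (vsum + 2)\<close>.\<close>

lemma hpoly_minus_one_eq_zero:
  assumes F: "odd_balanced M N F" and "N > 0" and zero: "\<And>i j. hpoly (- 1) F i j = 0"
  shows "F i j = 0"
proof (rule zero_if_hsum_plus_two_zero[of "F i"])
  show "F i (j - 1) + F i (j + 1) + 2 * F i j = 0" for j
    using zero[of i j] odd_balanced_sum[OF F, of i j] by (simp add: hpoly_def vsum_def)
qed (use odd_balanced_column[OF F] \<open>N > 0\<close> in auto)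

lemma sum_odd_balanced_eq_zero:
  assumes F: "odd_balanced M N F" and pos: "M > 0" "N > 0" and bound: "\<And>i j. \<bar>F i j\<bar> \<le> 1"
  shows "(\<Sum>i=1..M-1. \<Sum>j=1..N-1. F i j) = 0"
proof -
  \<comment> \<open>\<open>W = U(U+1)F\<close> and \<open>R = -(U^2+U-1)F\<close>: the two coprime
    factors differ by 1, whence \<open>F = W + R\<close>.\<close>
  define W where "W = hpoly 0 (hpoly 1 F)"
  define R where "R i j = 1 * F i j + (- 1) * W i j" for i j
  have W: "odd_balanced M N W" unfolding W_def by (intro odd_balanced_hpoly F)
  have R: "odd_balanced M N R" unfolding R_def[abs_def] by (intro odd_balanced_lincomb F W)

  have "hpoly 2 (hpoly (- 1) (hpoly 0 (hpoly 1 (hquint F)))) i j = 0" for i j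
    using dilated_sum_seven[OF odd_balanced_sum[OF F], of i j] bound[of i j]
      bound[of "i - 7" j] bound[of "i + 7" j] bound[of i "j - 7"] bound[of i "j + 7"]
    by linarith
  moreover have K: "odd_balanced M N (hpoly 0 (hpoly 1 (hquint F)))"
    by (intro odd_balanced_hpoly odd_balanced_hquint F)
  ultimately have "hpoly (- 1) (hpoly 0 (hpoly 1 (hquint F))) i j = 0" for i j
    using hpoly_two_eq_zero[OF odd_balanced_hpoly[OF K] pos(1)] by blast
  then have "hpoly 0 (hpoly 1 (hquint F)) i j = 0" for i j
    using hpoly_minus_one_eq_zero[OF K pos(2)] by blast
  moreover have "hpoly 0 (hpoly 1 (hquint F)) i j = hquint W i j" for i j
    by (simp add: W_def hpoly_def hquint_def hsum_def)
  ultimately have quint: "hquint W i j = 0" for i j by simp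
  \<comment> \<open>\<open>U(U+1)R = W - U(U+1)W = - hquint W\<close>.\<close>
  have tri: "hpoly 1 (hpoly 0 R) i j = 0" for i j
    using quint[of i j] by (simp add: R_def hpoly_def hquint_def hsum_def W_def)

  \<comment> \<open>Subtract two consecutive five-term sums, both zero.\<close>
  have "W (i + 5) j = W i j" for i j
    using quint[of "i + 2" j] quint[of "i + 3" j]
    by (simp add: hquint_def hsum_def algebra_simps)
  then have sum_W: "(\<Sum>i=1..M-1. W i j) = 0" for j
    by (intro sum_odd_about_odd_period[of _ _ 5] odd_balanced_row[OF W]) auto

  have R0: "odd_balanced M N (hpoly 0 R)" by (intro odd_balanced_hpoly R)
  \<comment> \<open>\<open>U + 1\<close> sums three consecutive values and annihilates
    \<open>U R\<close>.\<close>
  have "hpoly 0 R (i + 3) j = hpoly 0 R i j" for i j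
    using tri[of "i + 1" j] tri[of "i + 2" j]
    by (simp add: hpoly_def[of 1] hsum_def[of "hpoly 0 R"] algebra_simps)
  then have sum_R0: "(\<Sum>i=1..M-1. hpoly 0 R i j) = 0" for j
    by (intro sum_odd_about_odd_period[of _ _ 3] odd_balanced_row[OF R0]) auto

  have R1: "odd_balanced M N (hpoly 1 R)" by (intro odd_balanced_hpoly R)
  \<comment> \<open>\<open>U\<close> annihilates \<open>(U+1)R\<close>, so balance leaves
    \<open>1 + V\<close>, a vertical three-term sum.\<close>
  have "hsum (hpoly 1 R) i j = 0" for i j
    using tri[of i j] by (simp add: hpoly_def hsum_def)
  then have col: "hpoly 1 R i j + vsum (hpoly 1 R) i j = 0" for i j
    using odd_balanced_sum[OF R1, of i j] by simp
  have "hpoly 1 R i (j + 3) = hpoly 1 R i j" for i j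
    using col[of i "j + 1"] col[of i "j + 2"] by (simp add: vsum_def algebra_simps)
  then have sum_R1: "(\<Sum>j=1..N-1. hpoly 1 R i j) = 0" for i
    by (intro sum_odd_about_odd_period[of _ _ 3] odd_balanced_column[OF R1]) auto

  \<comment> \<open>Uses \<open>R = (U+1)R - U R\<close>. The first term is summed along
    \<open>j\<close>, the others along \<open>i\<close>, hence the swap below.\<close>
  have "F i j = hpoly 1 R i j + (W i j - hpoly 0 R i j)" for i j
    by (simp add: hpoly_def R_def)
  then have "(\<Sum>i=1..M-1. \<Sum>j=1..N-1. F i j)
    = (\<Sum>i=1..M-1. \<Sum>j=1..N-1. hpoly 1 R i j)
      + (\<Sum>i=1..M-1. \<Sum>j=1..N-1. W i j - hpoly 0 R i j)"
    by (simp add: sum.distrib)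
  also have "(\<Sum>i=1..M-1. \<Sum>j=1..N-1. W i j - hpoly 0 R i j)
    = (\<Sum>j=1..N-1. \<Sum>i=1..M-1. W i j - hpoly 0 R i j)"
    by (rule sum.swap)
  finally show ?thesis by (simp add: sum_subtractf sum_W sum_R0 sum_R1)
qed

section \<open>Odd extension from a rectangle to the lattice\<close>

text \<open>At residue \<open>M\<close> the value is \<open>- g M\<close>, which agrees with
  \<open>g M\<close> when \<open>g M = 0\<close>.\<close>

definition odd_ext :: "int \<Rightarrow> (int \<Rightarrow> int) \<Rightarrow> int \<Rightarrow> int" where
  "odd_ext M g i =
     (if i mod (2 * M) < M then g (i mod (2 * M)) else - g (2 * M - i mod (2 * M)))"

lemma odd_ext_eq:
  assumes "g M = 0" "0 \<le> i" "i \<le> M" "0 < M"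
  shows "odd_ext M g i = g i"
  using assms by (cases "i = M") (auto simp: odd_ext_def)

lemma odd_about_odd_ext:
  assumes "g 0 = 0" "g M = 0" "0 < M"
  shows "odd_about 0 (odd_ext M g)" "odd_about M (odd_ext M g)"
proof -
  have mod_uminus: "(- i) mod (2 * M) = (if i mod (2 * M) = 0 then 0 else 2 * M - i mod (2 * M))"
    for i by (rule zmod_zminus1_eq_if)
  have r: "0 \<le> i mod (2 * M)" "i mod (2 * M) < 2 * M" for i using assms(3) by simp_all
  have neg: "odd_ext M g (- i) = - odd_ext M g i" for i
    unfolding odd_ext_def mod_uminus using assms r[of i]
    by (cases "i mod (2 * M) = M") auto
  then show "odd_about 0 (odd_ext M g)" by (simp add: odd_about_def)
  have "(2 * M - i) mod (2 * M) = (- i) mod (2 * M)" for i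
    using mod_add_self1[of "2 * M" "- i"] by simp
  then have "odd_ext M g (2 * M - i) = odd_ext M g (- i)" for i
    by (simp add: odd_ext_def)
  then show "odd_about M (odd_ext M g)" by (simp add: odd_about_def neg)
qed

lemma odd_ext_odd_about:
  "(\<And>i. odd_about c (F i)) \<Longrightarrow> odd_about c (\<lambda>j. odd_ext M (\<lambda>a. F a j) i)"
  by (simp add: odd_about_def odd_ext_def)

lemma odd_balanced_extension:
  fixes G :: "int \<Rightarrow> int \<Rightarrow> int"
  assumes pos: "0 < M" "0 < N"
    and border: "\<And>j. G 0 j = 0" "\<And>j. G M j = 0" "\<And>i. G i 0 = 0" "\<And>i. G i N = 0"
    and bal: "\<And>i j. 0 < i \<Longrightarrow> i < M \<Longrightarrow> 0 < j \<Longrightarrow> j < N \<Longrightarrow> G i j + hsum G i j + vsum G i j = 0"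
    and bound: "\<And>i j. \<bar>G i j\<bar> \<le> 1"
  obtains F where "odd_balanced M N F" "\<And>i j. \<bar>F i j\<bar> \<le> 1"
    "\<And>i j. 0 \<le> i \<Longrightarrow> i \<le> M \<Longrightarrow> 0 \<le> j \<Longrightarrow> j \<le> N \<Longrightarrow> F i j = G i j"
proof -
  define F where "F i j = odd_ext M (\<lambda>a. odd_ext N (G a) j) i" for i j
  have zero_ext: "odd_ext N (G a) j = 0" if "a = 0 \<or> a = M" for a j
    using that border by (auto simp: odd_ext_def)
  have F_eq: "F i j = G i j" if "0 \<le> i" "i \<le> M" "0 \<le> j" "j \<le> N" for i j
    unfolding F_def using that pos border zero_ext by (simp add: odd_ext_eq)
  have odd: "doubly_odd M N F"
    unfolding doubly_odd_def F_def[abs_def]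
    using zero_ext border pos
    by (auto intro!: odd_about_odd_ext[of "\<lambda>a. odd_ext N (G a) j" for j] odd_ext_odd_about
        odd_about_odd_ext[of "G a" for a])
  \<comment> \<open>The plus sum of \<open>F\<close> is itself doubly odd, so its vanishing inside
    the rectangle carries over to the border lines and beyond.\<close>
  have "doubly_odd M N (\<lambda>i j. 1 * F i j + 1 * (1 * hsum F i j + 1 * vsum F i j))"
    by (intro doubly_odd_lincomb doubly_odd_hsum doubly_odd_vsum odd)
  then have "1 * F i j + 1 * (1 * hsum F i j + 1 * vsum F i j) = 0" for i j
  proof (rule zero_if_doubly_odd_zero[OF _ pos])
    fix i j assume "0 < i" "i < M" "0 < j" "j < N"
    then show "1 * F i j + 1 * (1 * hsum F i j + 1 * vsum F i j) = 0"
      using bal[of i j] by (simp add: hsum_def vsum_def F_eq)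
  qed
  then have "odd_balanced M N F" using odd by (simp add: odd_balanced_def add.assoc)
  moreover have "\<bar>F i j\<bar> \<le> 1" for i j
    using bound by (simp add: F_def odd_ext_def)
  ultimately show ?thesis using F_eq that by blast
qed

section \<open>Balanced domination functions on grids\<close>

text \<open>Truncated subtraction is harmless: \<open>i, j \<ge> 1\<close>, and an index
  \<open>0\<close> is removed by the intersection.\<close>

lemma closed_neighborhood_grid_graph:
  assumes "i \<in> {1..m}" "j \<in> {1..n}"
  shows "closed_neighborhood (grid_graph m n) (i, j)
    = {(i, j), (i - 1, j), (i + 1, j), (i, j - 1), (i, j + 1)} \<inter> {1..m} \<times> {1..n}"
  using assms
  by (auto simp: closed_neighborhood_def pverts_grid_graph parcs_grid_graph_iff)

lemma weight_grid_graph_eq_zero: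
  assumes f: "bdf (grid_graph m n) f"
  shows "weight (grid_graph m n) f = 0"
proof -
  define M N where "M = int m + 1" and "N = int n + 1"
  \<comment> \<open>Zero padding makes missing neighbours contribute \<open>0\<close> and supplies
    the zero border at \<open>0\<close>, \<open>M\<close> and \<open>N\<close> that the odd
    extension requires.\<close>
  define G where "G i j =
    (if 0 < i \<and> i < M \<and> 0 < j \<and> j < N then f (nat i, nat j) else 0)" for i j
  have val: "f (i, j) \<in> {-1, 0, 1}" if "i \<in> {1..m}" "j \<in> {1..n}" for i j
    using f that by (auto simp: bdf_def pverts_grid_graph)
  have G_nat: "G (int i) (int j) = (if (i, j) \<in> {1..m} \<times> {1..n} then f (i, j) else 0)" for i j
    by (auto simp: G_def M_def N_def)
  have bal: "G i j + hsum G i j + vsum G i j = 0" if "0 < i" "i < M" "0 < j" "j < N" for i j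
  proof -
    define a b where "a = nat i" and "b = nat j"
    have ab: "i = int a" "j = int b" "a \<in> {1..m}" "b \<in> {1..n}"
      using that by (auto simp: a_def b_def M_def N_def)
    have "0 = (\<Sum>u\<in>closed_neighborhood (grid_graph m n) (a, b). f u)"
      using f ab by (simp add: bdf_def pverts_grid_graph)
    also have "\<dots> = (\<Sum>u\<in>{(a, b), (a - 1, b), (a + 1, b), (a, b - 1), (a, b + 1)}.
        if u \<in> {1..m} \<times> {1..n} then f u else 0)"
      unfolding closed_neighborhood_grid_graph[OF ab(3,4)] by (rule sum.inter_restrict) simp
    also have "\<dots> = (\<Sum>u\<in>{(a, b), (a - 1, b), (a + 1, b), (a, b - 1), (a, b + 1)}.
        G (int (fst u)) (int (snd u)))"
      by (rule sum.cong) (auto simp: G_nat)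
    also have "\<dots> = G i j + hsum G i j + vsum G i j"
      using ab by (cases a; cases b) (simp_all add: hsum_def vsum_def algebra_simps)
    finally show ?thesis by simp
  qed
  have bound: "\<bar>G i j\<bar> \<le> 1" for i j
  proof (cases "nat i \<in> {1..m} \<and> nat j \<in> {1..n}")
    case True
    then show ?thesis using val[of "nat i" "nat j"] by (auto simp: G_def)
  qed (auto simp: G_def M_def N_def)
  obtain F where F: "odd_balanced M N F" "\<And>i j. \<bar>F i j\<bar> \<le> 1"
    and F_eq: "\<And>i j. 0 \<le> i \<Longrightarrow> i \<le> M \<Longrightarrow> 0 \<le> j \<Longrightarrow> j \<le> N \<Longrightarrow> F i j = G i j"
    by (rule odd_balanced_extension[of M N G]) (use bal bound in \<open>auto simp: G_def M_def N_def\<close>)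
  have "weight (grid_graph m n) f = (\<Sum>(i, j)\<in>{1..m} \<times> {1..n}. f (i, j))"
    by (simp add: weight_def pverts_grid_graph)
  also have "\<dots> = (\<Sum>(i, j)\<in>{1..M-1} \<times> {1..N-1}. F i j)"
    by (rule sum.reindex_bij_witness[of _ "\<lambda>(i, j). (nat i, nat j)" "\<lambda>(i, j). (int i, int j)"])
      (auto simp: M_def N_def F_eq G_nat)
  also have "\<dots> = (\<Sum>i=1..M-1. \<Sum>j=1..N-1. F i j)"
    by (simp add: sum.cartesian_product)
  also have "\<dots> = 0"
    by (rule sum_odd_balanced_eq_zero[OF F(1) _ _ F(2)]) (simp_all add: M_def N_def)
  finally show ?thesis .
qed

theorem mainTheorem7:
  fixes m n :: nat
  assumes "3 \<le> m" and "m \<le> n"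
  shows "d_balanced (grid_graph m n)"
proof -
  have "{weight (grid_graph m n) f | f. bdf (grid_graph m n) f} \<subseteq> {0}"
    using weight_grid_graph_eq_zero by blast
  \<comment> \<open>The zero function excludes the empty set, so \<open>Max\<close> is taken over a
    singleton.\<close>
  then have "{weight (grid_graph m n) f | f. bdf (grid_graph m n) f} = {0}"
    by (rule subset_singletonD[THEN disjE]) (simp_all only: weights_nonempty simp_thms)
  then show ?thesis by (simp add: d_balanced_def balanced_domination_number_def)
qed

end
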